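(* Let $\gamma(s)=(x(s),y(s))$ be a parametrized curve in $\mathbb{H}^2$ that under the curve shortening flow evolves by geodesic translations along $V=(1,0)$. Then $\gamma$ is an equidistant line of curvature $\frac{1}{\sqrt2}$ and the flow is given by $$\gamma(t,s)=\left(s+(m-s)\tanh(t),\ \frac{m-s}{\cosh(t)}\right),$$ where $m\in\mathbb{R}$ is an integration constant. Furthermore: (1) the flow is defined for all $t\in\mathbb{R}$, where if $t\to\infty$, then $\gamma_t$ approaches the geodesic $s\mapsto(m,s)$, and if $t\to-\infty$, then $\gamma_t$ approaches the ideal boundary $\mathbb{H}^2_\infty$; (2) for fixed $t$, the curve $\gamma_t$ is an equidistant line of curvature $\kappa=\tanh(t)$.
   Context: $\mathbb{H}^2$ is the upper half-plane $\{(x,y)\in\mathbb{R}^2: y>0\}$ with the metric $\langle\,,\rangle=\frac{dx^2+dy^2}{y^2}$; its ideal boundary $\mathbb{H}^2_\infty=\{y=0\}\cup\{\infty\}$ is the one-point compactification of the line $\{y=0\}$. For a parametrized curve $u\mapsto(x(u),y(u))$, the unit normal is $N=\frac{y}{\sqrt{x'^2+y'^2}}(-y',x')$ and the (geodesic) curvature is $\kappa=y\frac{x'y''-x''y'}{(x'^2+y'^2)^{3/2}}+\frac{x'}{\sqrt{x'^2+y'^2}}$. A one-parameter family of curves $\gamma_t=\gamma(t,\cdot)$ is the curve shortening flow (CSF) of $\gamma$ if $(\partial_t\gamma_t)^\perp=\kappa(t,\cdot)N(t,\cdot)$ and $\gamma_0=\gamma$, where $\kappa(t,\cdot)$ and $N(t,\cdot)$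 are the curvature and unit normal of $\gamma_t$ and $\perp$ denotes the normal part. Geodesic translations move each point $p$ along the geodesic $\eta(t)=\eta(t;p,V)$ that passes through $p$ at $t=0$ in the direction $V$. For $p=(x,y)$ and $V=(1,0)$ this geodesic is $\eta(t)=\left(x+y\tanh(t),\frac{y}{\cosh(t)}\right)$. Thus $\gamma$ evolves under CSF by geodesic translations along $V=(1,0)$ if its flow is $\gamma(t,s)=\left(x(s)+y(s)\tanh(t),\frac{y(s)}{\cosh(t)}\right)$. Geodesics of $\mathbb{H}^2$ are the vertical half-lines from the line $\{y=0\}$ and the half-circles with center on $\{y=0\}$. An equidistant line is a set of points equidistant from a given geodesic; equidistant lines are the non-geodesic arcs of circles and the non-vertical half-lines from points of $\{y=0\}$, and their curvature is a number between $0$ and $1$.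
   Formalization: In (2) the curvature tanh(t) is false (at t=0 it is 1/√2) and is corrected to sqrt((1−tanh t)/2); γ may be an open arc of the equidistant line, being all of it when properly immersed, and the flow formula holds after a change of parameter, with |κ|=1/√2 for γ. *)

theory Defs
  imports "HOL-Analysis.Analysis"
begin

section \<open>The upper half-plane\<close>

definition H2 :: "(real \<times> real) set" where
  "H2 = {p. snd p > 0}"

definition hyp_inner :: "real \<times> real \<Rightarrow> real \<times> real \<Rightarrow> real \<times> real \<Rightarrow> real" where
  "hyp_inner p v w = (v \<bullet> w) / (snd p)\<^sup>2"

definition hyp_norm :: "real \<times> real \<Rightarrow> real \<times> real \<Rightarrow> real" where
  "hyp_norm p v = sqrt (hyp_inner p v v)"

abbreviation velocity :: "(real \<Rightarrow> 'a::real_normed_vector) \<Rightarrow> real \<Rightarrow> 'a" where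
  "velocity c u \<equiv> vector_derivative c (at u)"

definition hyp_length :: "(real \<Rightarrow> real \<times> real) \<Rightarrow> real" where
  "hyp_length c = integral {0..1} (\<lambda>u. hyp_norm (c u) (velocity c u))"

text \<open>The Riemannian distance. The infimum runs over C1 paths; they need not be regular, so this
  is the same infimum as over piecewise C1 paths, and the speed is always integrable.\<close>

definition hyp_dist :: "real \<times> real \<Rightarrow> real \<times> real \<Rightarrow> real" where
  "hyp_dist p q = Inf {hyp_length c |c.
     c C1_differentiable_on {0..1} \<and> c ` {0..1} \<subseteq> H2 \<and> c 0 = p \<and> c 1 = q}"

definition hyp_infdist :: "real \<times> real \<Rightarrow> (real \<times> real) set \<Rightarrow> real" where
  "hyp_infdist p A = (INF q\<in>A. hyp_dist p q)"

definition vertical_geodesic :: "real \<Rightarrow> (real \<times> real) set" where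
  "vertical_geodesic a = (\<lambda>s. (a, s)) ` {0<..}"

definition is_geodesic :: "(real \<times> real) set \<Rightarrow> bool" where
  "is_geodesic g \<longleftrightarrow>
     (\<exists>a. g = vertical_geodesic a) \<or>
     (\<exists>a r. r > 0 \<and> g = {(x, y). y > 0 \<and> (x - a)\<^sup>2 + y\<^sup>2 = r\<^sup>2})"

text \<open>The points at distance \<open>d > 0\<close> from a geodesic form two connected curves, one on each side;
  an equidistant line is one of them.\<close>

definition equidistant_line :: "(real \<times> real) set \<Rightarrow> bool" where
  "equidistant_line E \<longleftrightarrow>
     (\<exists>g d. is_geodesic g \<and> d > 0 \<and> E \<in> components {p \<in> H2. hyp_infdist p g = d})"


section \<open>Curves, curvature and the curve shortening flow\<close>

text \<open>Twice continuously differentiable with nowhere vanishing velocity. It is used both for plane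
  curves and for changes of parameter.\<close>

definition regular_on :: "real set \<Rightarrow> (real \<Rightarrow> 'a::real_normed_vector) \<Rightarrow> bool" where
  "regular_on J c \<longleftrightarrow>
     (\<forall>u\<in>J. c differentiable at u \<and> velocity c u \<noteq> 0) \<and> velocity c C1_differentiable_on J"

definition param_curve :: "real set \<Rightarrow> (real \<Rightarrow> real \<times> real) \<Rightarrow> bool" where
  "param_curve J c \<longleftrightarrow>
     open J \<and> is_interval J \<and> J \<noteq> {} \<and> regular_on J c \<and> c ` J \<subseteq> H2"

definition unit_normal :: "(real \<Rightarrow> real \<times> real) \<Rightarrow> real \<Rightarrow> real \<times> real" where
  "unit_normal c u =
     (let y = snd (c u); x' = fst (velocity c u); y' = snd (velocity c u)
      in (y / sqrt (x'\<^sup>2 + y'\<^sup>2)) *\<^sub>R (- y', x'))"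

definition curvature :: "(real \<Rightarrow> real \<times> real) \<Rightarrow> real \<Rightarrow> real" where
  "curvature c u =
     (let y = snd (c u);
          x' = fst (velocity c u); y' = snd (velocity c u);
          x'' = fst (velocity (velocity c) u); y'' = snd (velocity (velocity c) u)
      in y * ((x' * y'' - x'' * y') / (x'\<^sup>2 + y'\<^sup>2) powr (3/2)) + x' / sqrt (x'\<^sup>2 + y'\<^sup>2))"

definition normal_part :: "(real \<Rightarrow> real \<times> real) \<Rightarrow> real \<Rightarrow> real \<times> real \<Rightarrow> real \<times> real" where
  "normal_part c u v = hyp_inner (c u) v (unit_normal c u) *\<^sub>R unit_normal c u"

text \<open>\<open>\<Gamma> t s\<close> is the point of the curve at time \<open>t\<close> with parameter \<open>s\<close>. The time
  interval \<open>T\<close> may be of any kind (for instance \<open>{0..<\<epsilon>}\<close>), hence the derivative within \<open>T\<close>.\<close>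

definition curve_shortening_flow ::
    "real set \<Rightarrow> real set \<Rightarrow> (real \<Rightarrow> real \<times> real) \<Rightarrow> (real \<Rightarrow> real \<Rightarrow> real \<times> real) \<Rightarrow> bool" where
  "curve_shortening_flow T J \<gamma> \<Gamma> \<longleftrightarrow>
     is_interval T \<and> 0 \<in> T \<and> T \<noteq> {0} \<and>
     (\<forall>t\<in>T. param_curve J (\<Gamma> t)) \<and>
     (\<forall>s\<in>J. \<Gamma> 0 s = \<gamma> s) \<and>
     (\<forall>t\<in>T. \<forall>s\<in>J. \<exists>v. ((\<lambda>\<tau>. \<Gamma> \<tau> s) has_vector_derivative v) (at t within T) \<and>
        normal_part (\<Gamma> t) s v = curvature (\<Gamma> t) s *\<^sub>R unit_normal (\<Gamma> t) s)"

text \<open>The point at time \<open>t\<close> on the geodesic that starts at the given point in the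
  direction \<open>V = (1, 0)\<close>.\<close>

definition geodesic_translation :: "real \<Rightarrow> real \<times> real \<Rightarrow> real \<times> real" where
  "geodesic_translation t p = (fst p + snd p * tanh t, snd p / cosh t)"

definition evolves_by_geodesic_translations ::
    "real set \<Rightarrow> real set \<Rightarrow> (real \<Rightarrow> real \<times> real) \<Rightarrow> bool" where
  "evolves_by_geodesic_translations T J \<gamma> \<longleftrightarrow>
     curve_shortening_flow T J \<gamma> (\<lambda>t s. geodesic_translation t (\<gamma> s))"

text \<open>The explicit flow. It lies in \<open>H2\<close> exactly for \<open>s < m\<close>. Its slice at time \<open>t\<close> is a straight
  half-line from \<open>(m, 0)\<close> whose curvature is \<open>sqrt ((1 - tanh t) / 2)\<close>, which
  is \<open>1 / sqrt 2\<close> at \<open>t = 0\<close>.\<close>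

definition translation_flow :: "real \<Rightarrow> real \<Rightarrow> real \<Rightarrow> real \<times> real" where
  "translation_flow m t s = (s + (m - s) * tanh t, (m - s) / cosh t)"


section \<open>Convergence of curves\<close>

text \<open>Convergence to a set in the hyperbolic Hausdorff distance.\<close>

definition approaches :: "('t \<Rightarrow> (real \<times> real) set) \<Rightarrow> (real \<times> real) set \<Rightarrow> 't filter \<Rightarrow> bool" where
  "approaches A B F \<longleftrightarrow>
     (\<forall>\<epsilon>>0. \<forall>\<^sub>F t in F. (\<forall>p\<in>A t. hyp_infdist p B < \<epsilon>) \<and> (\<forall>q\<in>B. hyp_infdist q (A t) < \<epsilon>))"

text \<open>The union of \<open>H2\<close> and its ideal boundary is the one-point compactification of the closed
  half-plane; \<open>None\<close> is the point at infinity.\<close>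

definition closed_half_plane :: "(real \<times> real) set" where
  "closed_half_plane = {p. snd p \<ge> 0}"

definition compactified_H2 :: "(real \<times> real) option topology" where
  "compactified_H2 = Alexandroff_compactification (top_of_set closed_half_plane)"

definition ideal_boundary :: "(real \<times> real) option set" where
  "ideal_boundary = insert None (Some ` {p. snd p = 0})"

text \<open>Every neighbourhood of the ideal boundary contains the whole set from some moment on.\<close>

definition approaches_ideal_boundary :: "('t \<Rightarrow> (real \<times> real) set) \<Rightarrow> 't filter \<Rightarrow> bool" where
  "approaches_ideal_boundary A F \<longleftrightarrow>
     (\<forall>U. openin compactified_H2 U \<and> ideal_boundary \<subseteq> U \<longrightarrow> (\<forall>\<^sub>F t in F. Some ` A t \<subseteq> U))"

end

theory Submission
  imports Defs
begin

text \<open>Write \<open>\<gamma> = (x, y)\<close> and \<open>T = tanh t\<close>. A translation \<open>(x, y) \<mapsto> (x + y T, y / cosh t)\<close> is linear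
  in \<open>(x, y)\<close>, so velocity and acceleration of the translated curve are the translated velocity and
  acceleration of \<open>\<gamma>\<close>. Substituting them in the flow equation and cancelling the positive factor
  \<open>1 + T\<close> leaves (\<open>translated_csf_equation_iff\<close>)
  \[ (x' + y')\,(x'^2 + y'^2 + 2 T x' y') + (1 - T)\, y\, (x' y'' - x'' y') = 0. \]
  This is affine in \<open>T\<close>, so two different times already determine it: elimination of the acceleration
  term between time \<open>0\<close> and a second time gives \<open>(x' + y')^3 = 0\<close>. Hence \<open>x + y\<close> is a constant \<open>m\<close>,
  and conversely the equation holds at all times when \<open>x + y\<close> is constant. The parameter \<open>\<phi>\<close> is \<open>x\<close>
  itself; it is injective because \<open>x' = - y'\<close> cannot vanish on a regular curve. If \<open>\<gamma>\<close> is proper,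
  the range of \<open>\<phi>\<close> is open and closed in \<open>{..<m}\<close>, hence everything.

  The slice of the flow at time \<open>t\<close> is the half-line from \<open>(m, 0)\<close> on which
  \<open>(x - m) / y = - exp (- t)\<close> (\<open>translation_flow_image\<close>). The geometry rests on one formula: the
  distance from \<open>(x, y)\<close> to the vertical geodesic over \<open>m\<close> is \<open>\<bar>arsinh ((x - m) / y)\<bar>\<close>. The function
  \<open>arsinh ((x - m) / y)\<close> is 1-Lipschitz and vanishes on the geodesic, which bounds the
  distance from below; the half-circle about \<open>(m, 0)\<close>, along which the translations move with unit
  speed, attains the bound. Therefore the slice is one of the two equidistant lines at distance
  \<open>arsinh (exp (- t))\<close>, which tends to \<open>0\<close> as \<open>t \<rightarrow> \<infinity>\<close>. As \<open>t \<rightarrow> -\<infinity>\<close> the half-line flattens out and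
  leaves every compact subset of the half-plane.\<close>

section \<open>Distance to a vertical geodesic\<close>

lemma hyp_norm_eq: "snd p > 0 \<Longrightarrow> hyp_norm p v = norm v / snd p"
  by (simp add: hyp_norm_def hyp_inner_def real_sqrt_divide norm_eq_sqrt_inner)

lemma speed_integrable:
  assumes "c C1_differentiable_on {0..1}" and "c ` {0..1} \<subseteq> H2"
  shows "(\<lambda>u. hyp_norm (c u) (velocity c u)) integrable_on {0..1}"
proof -
  have pos: "snd (c u) > 0" if "u \<in> {0..1}" for u
    using assms(2) that by (force simp: H2_def)
  have "continuous_on {0..1} c" and "continuous_on {0..1} (velocity c)"
    using assms(1) by (auto simp: C1_differentiable_on_eq intro: continuous_at_imp_continuous_on
        differentiable_imp_continuous_within)
  then have "continuous_on {0..1} (\<lambda>u. norm (velocity c u) / snd (c u))"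
    using pos by (intro continuous_intros) (auto simp: less_imp_neq[THEN not_sym])
  moreover have "continuous_on {0..1} (\<lambda>u. norm (velocity c u) / snd (c u)) \<longleftrightarrow>
      continuous_on {0..1} (\<lambda>u. hyp_norm (c u) (velocity c u))"
    using pos by (intro continuous_on_cong) (auto simp: hyp_norm_eq)
  ultimately show ?thesis
    by (auto intro: integrable_continuous_interval)
qed

lemma hyp_length_nonneg:
  assumes "c C1_differentiable_on {0..1}" and "c ` {0..1} \<subseteq> H2"
  shows "0 \<le> hyp_length c"
  unfolding hyp_length_def
  by (rule integral_nonneg[OF speed_integrable[OF assms]])
    (simp add: hyp_norm_def hyp_inner_def)

lemma hyp_dist_le_length:
  assumes "c C1_differentiable_on {0..1}" and "c ` {0..1} \<subseteq> H2" and "c 0 = p" and "c 1 = q"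
  shows "hyp_dist p q \<le> hyp_length c"
  unfolding hyp_dist_def
  by (rule cInf_lower) (use assms hyp_length_nonneg in \<open>auto intro!: bdd_belowI[of _ 0]\<close>)

text \<open>The segment from \<open>p\<close> to \<open>q\<close> is an admissible path, so the infimum in \<open>hyp_dist\<close> is not that of the
  empty set and every common lower bound of the lengths is a lower bound of the distance.\<close>

lemma hyp_dist_greatest:
  assumes "p \<in> H2" and "q \<in> H2"
    and lower: "\<And>c. c C1_differentiable_on {0..1} \<Longrightarrow> c ` {0..1} \<subseteq> H2 \<Longrightarrow>
      c 0 = p \<Longrightarrow> c 1 = q \<Longrightarrow> b \<le> hyp_length c"
  shows "b \<le> hyp_dist p q"
proof -
  have "convex H2"
    using convex_linear_vimage[OF _ convex_real_interval(3), of "snd :: real \<times> real \<Rightarrow> real" 0]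
    by (simp add: H2_def linear_snd vimage_def)
  then have "closed_segment p q \<subseteq> H2"
    using assms(1,2) by (rule closed_segment_subset[rotated 2])
  moreover have "linepath p q C1_differentiable_on {0..1}"
    unfolding linepath_def by (intro derivative_intros)
  ultimately have "\<exists>c. c C1_differentiable_on {0..1} \<and> c ` {0..1} \<subseteq> H2 \<and> c 0 = p \<and> c 1 = q"
    by (intro exI[of _ "linepath p q"])
      (auto simp: linepath_image_01 linepath_0' linepath_1')
  then show ?thesis
    unfolding hyp_dist_def by (intro cInf_greatest) (auto intro: lower)
qed

lemma hyp_infdist_le:
  assumes "p \<in> H2" and "A \<subseteq> H2" and "q \<in> A"
  shows "hyp_infdist p A \<le> hyp_dist p q"
  unfolding hyp_infdist_def
proof (rule cINF_lower)
  have "0 \<le> hyp_dist p r" if "r \<in> A" for r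
    using assms that by (intro hyp_dist_greatest) (auto intro: hyp_length_nonneg)
  then show "bdd_below (hyp_dist p ` A)"
    by (auto intro!: bdd_belowI[of _ 0])
qed fact

lemma cauchy_schwarz_cross:
  fixes a b x y :: real
  shows "\<bar>a * y - x * b\<bar> \<le> sqrt (a\<^sup>2 + b\<^sup>2) * sqrt (x\<^sup>2 + y\<^sup>2)"
proof -
  have "(a * y - x * b)\<^sup>2 + (a * x + b * y)\<^sup>2 = (a\<^sup>2 + b\<^sup>2) * (x\<^sup>2 + y\<^sup>2)"
    by algebra
  then have "(a * y - x * b)\<^sup>2 \<le> (a\<^sup>2 + b\<^sup>2) * (x\<^sup>2 + y\<^sup>2)"
    by (smt (verit) zero_le_power2)
  then show ?thesis
    by (metis real_sqrt_abs real_sqrt_le_mono real_sqrt_mult)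
qed

text \<open>The Euclidean gradient of \<open>(x, y) \<mapsto> arsinh ((x - m) / y)\<close> has norm \<open>1 / y\<close>, hence its hyperbolic
  gradient has norm \<open>1\<close>: this is the signed distance to the vertical geodesic over \<open>m\<close>.\<close>

lemma arsinh_slope_le_length:
  assumes c: "c C1_differentiable_on {0..1}" "c ` {0..1} \<subseteq> H2"
  shows "\<bar>arsinh ((fst (c 1) - m) / snd (c 1)) - arsinh ((fst (c 0) - m) / snd (c 0))\<bar>
    \<le> hyp_length c"
proof -
  define f where "f = (\<lambda>u. arsinh ((fst (c u) - m) / snd (c u)))"
  define f' where "f' = (\<lambda>u.
    (fst (velocity c u) * snd (c u) - (fst (c u) - m) * snd (velocity c u)) / (snd (c u))\<^sup>2
      / sqrt (((fst (c u) - m) / snd (c u))\<^sup>2 + 1))"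
  have pos: "snd (c u) > 0" if "u \<in> {0..1}" for u
    using c(2) that by (force simp: H2_def)
  have deriv: "(f has_real_derivative f' u) (at u within {0..1})" if u: "u \<in> {0..1}" for u
  proof -
    have v: "(c has_vector_derivative velocity c u) (at u)"
      using c(1) u by (auto simp: C1_differentiable_on_eq vector_derivative_works)
    have x: "((\<lambda>u. fst (c u)) has_real_derivative fst (velocity c u)) (at u)"
      and y: "((\<lambda>u. snd (c u)) has_real_derivative snd (velocity c u)) (at u)"
      using bounded_linear.has_vector_derivative[OF bounded_linear_fst v]
        bounded_linear.has_vector_derivative[OF bounded_linear_snd v]
      by (simp_all add: has_real_derivative_iff_has_vector_derivative)
    have "(f has_real_derivative f' u) (at u)"
      unfolding f_def f'_def using pos[OF u]
      by (intro DERIV_cong[OF DERIV_chain2[OF arsinh_real_has_field_derivative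
              DERIV_divide[OF DERIV_diff[OF x DERIV_const] y]]])
        (auto simp: power2_eq_square)
    then show ?thesis
      by (rule has_field_derivative_at_within)
  qed
  have I: "(f' has_integral f 1 - f 0) {0..1}"
    using deriv by (intro fundamental_theorem_of_calculus)
      (auto simp: has_real_derivative_iff_has_vector_derivative)
  have bound: "norm (f' u) \<le> hyp_norm (c u) (velocity c u)" if "u \<in> {0..1}" for u
  proof -
    define a b x y where "a = fst (velocity c u)" and "b = snd (velocity c u)"
      and "x = fst (c u) - m" and "y = snd (c u)"
    have y: "y > 0" using pos[OF that] by (simp add: y_def)
    then have r: "sqrt (x\<^sup>2 + y\<^sup>2) > 0"
      by (simp add: add_nonneg_pos)
    have "sqrt ((x / y)\<^sup>2 + 1) = sqrt ((x\<^sup>2 + y\<^sup>2) / y\<^sup>2)"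
      using y by (simp add: field_simps)
    also have "\<dots> = sqrt (x\<^sup>2 + y\<^sup>2) / y"
      using y by (simp add: real_sqrt_divide)
    finally have "f' u = (a * y - x * b) / (y * sqrt (x\<^sup>2 + y\<^sup>2))"
      using y by (simp add: f'_def a_def b_def x_def[symmetric] y_def[symmetric] power2_eq_square)
    then have "norm (f' u) = \<bar>a * y - x * b\<bar> / (y * sqrt (x\<^sup>2 + y\<^sup>2))"
      using y by (simp add: abs_mult)
    also have "\<dots> \<le> sqrt (a\<^sup>2 + b\<^sup>2) * sqrt (x\<^sup>2 + y\<^sup>2) / (y * sqrt (x\<^sup>2 + y\<^sup>2))"
      using y r by (intro divide_right_mono cauchy_schwarz_cross) auto
    also have "\<dots> = hyp_norm (c u) (velocity c u)"
      using y r by (simp add: hyp_norm_eq norm_prod_def a_def b_def y_def)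
    finally show ?thesis .
  qed
  have "norm (integral {0..1} f') \<le> integral {0..1} (\<lambda>u. hyp_norm (c u) (velocity c u))"
    using I bound speed_integrable[OF c] by (intro integral_norm_bound_integral) auto
  then show ?thesis
    using I by (simp add: integral_unique hyp_length_def f_def)
qed

lemma one_minus_tanh_square: "1 - (tanh t)\<^sup>2 = 1 / (cosh t)\<^sup>2" for t :: real
proof -
  have "(cosh t)\<^sup>2 - (sinh t)\<^sup>2 = 1" by (simp add: cosh_square_eq)
  then have "1 / (cosh t)\<^sup>2 = ((cosh t)\<^sup>2 - (sinh t)\<^sup>2) / (cosh t)\<^sup>2" by simp
  also have "\<dots> = 1 - (tanh t)\<^sup>2" by (simp add: tanh_def diff_divide_distrib power_divide)
  finally show ?thesis by simp
qed

lemma one_minus_tanh: "1 - tanh t = exp (- t) / cosh t" for t :: real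
  by (simp add: tanh_def field_simps flip: cosh_minus_sinh)

lemma geodesic_translation_in_H2: "p \<in> H2 \<Longrightarrow> geodesic_translation t p \<in> H2"
  by (simp add: H2_def geodesic_translation_def)

lemma geodesic_translation_has_vector_derivative:
  "((\<lambda>t. geodesic_translation t p) has_vector_derivative
     (snd p / (cosh t)\<^sup>2, - snd p * tanh t / cosh t)) (at t within S)"
proof -
  have "((\<lambda>t. fst p + snd p * tanh t) has_real_derivative snd p * (1 - (tanh t)\<^sup>2)) (at t)"
    by (rule derivative_eq_intros refl | simp)+
  then have x: "((\<lambda>t. fst p + snd p * tanh t) has_vector_derivative snd p / (cosh t)\<^sup>2) (at t)"
    unfolding one_minus_tanh_square has_real_derivative_iff_has_vector_derivative by simp
  have "((\<lambda>t. snd p / cosh t) has_real_derivative - snd p * tanh t / cosh t) (at t)"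
    by (rule derivative_eq_intros refl | simp add: tanh_def)+
  then have y: "((\<lambda>t. snd p / cosh t) has_vector_derivative - snd p * tanh t / cosh t) (at t)"
    unfolding has_real_derivative_iff_has_vector_derivative .
  show ?thesis
    unfolding geodesic_translation_def
    by (rule has_vector_derivative_at_within[OF has_vector_derivative_Pair[OF x y]])
qed

text \<open>The curve \<open>t \<mapsto> geodesic_translation t p\<close> has unit speed.\<close>

lemma hyp_dist_geodesic_translation_le:
  assumes p: "p \<in> H2"
  shows "hyp_dist (geodesic_translation a p) (geodesic_translation b p) \<le> \<bar>b - a\<bar>"
proof -
  define c where "c = (\<lambda>u. geodesic_translation (a + u * (b - a)) p)"
  have y: "snd p > 0" using p by (simp add: H2_def)
  have v: "(c has_vector_derivative (b - a) *\<^sub>R (snd p / (cosh (a + u * (b - a)))\<^sup>2,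
        - snd p * tanh (a + u * (b - a)) / cosh (a + u * (b - a)))) (at u)" for u
  proof -
    have "((\<lambda>u. a + u * (b - a)) has_vector_derivative b - a) (at u)"
      by (auto intro!: derivative_eq_intros simp flip: has_real_derivative_iff_has_vector_derivative)
    from vector_diff_chain_at[OF this geodesic_translation_has_vector_derivative]
    show ?thesis by (simp add: c_def o_def)
  qed
  have C1: "c C1_differentiable_on {0..1}"
    unfolding C1_differentiable_on_def
    by (rule exI, intro conjI ballI, rule v) (intro continuous_intros; simp)
  have in_H2: "c u \<in> H2" for u
    unfolding c_def by (intro geodesic_translation_in_H2 p)
  have speed: "hyp_norm (c u) (velocity c u) = \<bar>b - a\<bar>" for u
  proof -
    define T C where "T = tanh (a + u * (b - a))" and "C = cosh (a + u * (b - a))"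
    have C: "C > 0" and T: "T\<^sup>2 = 1 - 1 / C\<^sup>2"
      using one_minus_tanh_square[of "a + u * (b - a)"] by (auto simp: C_def T_def)
    have "norm (snd p / C\<^sup>2, - snd p * T / C) = sqrt ((snd p / C)\<^sup>2 * (1 / C\<^sup>2 + T\<^sup>2))"
      using C by (simp add: norm_prod_def field_simps power2_eq_square)
    also have "\<dots> = snd p / C"
      using C y by (simp add: T)
    finally have n: "norm (snd p / C\<^sup>2, - snd p * T / C) = snd p / C" .
    have "norm (velocity c u) = \<bar>b - a\<bar> * (snd p / C)"
      unfolding vector_derivative_at[OF v] norm_scaleR C_def[symmetric] T_def[symmetric] n by simp
    moreover have "snd (c u) = snd p / C"
      by (simp add: c_def C_def geodesic_translation_def)
    ultimately show ?thesis
      using y C by (simp add: hyp_norm_eq)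
  qed
  have "hyp_dist (c 0) (c 1) \<le> hyp_length c"
    using C1 in_H2 by (intro hyp_dist_le_length) auto
  then show ?thesis
    by (simp add: hyp_length_def speed) (simp add: c_def)
qed

lemma vertical_geodesic_subset_H2: "vertical_geodesic m \<subseteq> H2"
  by (auto simp: vertical_geodesic_def H2_def)

text \<open>Every point lies on a half-circle about \<open>(m, 0)\<close>. Its foot point on the vertical geodesic is
  \<open>(m, h)\<close>, the top of this circle.\<close>

lemma polar_coordinates_vertical:
  assumes "snd p > 0"
  obtains h where "h > 0"
    and "p = geodesic_translation (arsinh ((fst p - m) / snd p)) (m, h)"
proof -
  define \<tau> where "\<tau> = arsinh ((fst p - m) / snd p)"
  have "sinh \<tau> = (fst p - m) / snd p" by (simp add: \<tau>_def)
  then have "p = geodesic_translation \<tau> (m, snd p * cosh \<tau>)"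
    using assms by (simp add: geodesic_translation_def tanh_def prod_eq_iff)
  then show thesis
    using assms that[of "snd p * cosh \<tau>"] by (simp add: \<tau>_def)
qed

lemma hyp_infdist_vertical_geodesic:
  assumes p: "p \<in> H2"
  shows "hyp_infdist p (vertical_geodesic m) = \<bar>arsinh ((fst p - m) / snd p)\<bar>"
proof (rule antisym)
  define \<tau> where "\<tau> = arsinh ((fst p - m) / snd p)"
  obtain h where h: "h > 0" "p = geodesic_translation \<tau> (m, h)"
    unfolding \<tau>_def using polar_coordinates_vertical[of p m] p by (auto simp: H2_def)
  have q: "(m, h) \<in> vertical_geodesic m"
    using h(1) by (auto simp: vertical_geodesic_def)
  have "hyp_infdist p (vertical_geodesic m) \<le> hyp_dist p (m, h)"
    by (rule hyp_infdist_le[OF p vertical_geodesic_subset_H2 q])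
  also have "\<dots> = hyp_dist (geodesic_translation \<tau> (m, h)) (geodesic_translation 0 (m, h))"
    using h(2) by (simp add: geodesic_translation_def[of 0])
  also have "\<dots> \<le> \<bar>\<tau>\<bar>"
    using hyp_dist_geodesic_translation_le[of "(m, h)" \<tau> 0] h(1) by (simp add: H2_def)
  finally show "hyp_infdist p (vertical_geodesic m) \<le> \<bar>arsinh ((fst p - m) / snd p)\<bar>"
    by (simp add: \<tau>_def)
next
  have "\<bar>arsinh ((fst p - m) / snd p)\<bar> \<le> hyp_dist p q" if q: "q \<in> vertical_geodesic m" for q
  proof (rule hyp_dist_greatest[OF p])
    show "q \<in> H2" using q vertical_geodesic_subset_H2 by blast
    have "fst q = m" using q by (auto simp: vertical_geodesic_def)
    then show "\<bar>arsinh ((fst p - m) / snd p)\<bar> \<le> hyp_length c"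
      if "c C1_differentiable_on {0..1}" "c ` {0..1} \<subseteq> H2" "c 0 = p" "c 1 = q" for c
      using arsinh_slope_le_length[OF that(1,2), of m] that(3,4) by simp
  qed
  then show "\<bar>arsinh ((fst p - m) / snd p)\<bar> \<le> hyp_infdist p (vertical_geodesic m)"
    unfolding hyp_infdist_def by (intro cINF_greatest) (auto simp: vertical_geodesic_def)
qed


section \<open>The oblique rays swept out by the flow\<close>

definition oblique_ray :: "real \<Rightarrow> real \<Rightarrow> (real \<times> real) set" where
  "oblique_ray m k = {p. snd p > 0 \<and> fst p = m - k * snd p}"

lemma oblique_ray_subset_H2: "oblique_ray m k \<subseteq> H2"
  by (auto simp: oblique_ray_def H2_def)

lemma translation_flow_image: "translation_flow m t ` {..<m} = oblique_ray m (exp (- t))"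
proof (intro equalityI subsetI)
  fix p assume "p \<in> translation_flow m t ` {..<m}"
  then obtain s where s: "s < m" "p = translation_flow m t s" by auto
  have "s + (m - s) * tanh t = m - (m - s) * (1 - tanh t)" by algebra
  then show "p \<in> oblique_ray m (exp (- t))"
    using s by (simp add: oblique_ray_def translation_flow_def one_minus_tanh)
next
  fix p assume p: "p \<in> oblique_ray m (exp (- t))"
  define s where "s = m - snd p * cosh t"
  have "s + (m - s) * tanh t = m - (m - s) * (1 - tanh t)" by algebra
  then have "p = translation_flow m t s"
    using p by (simp add: oblique_ray_def translation_flow_def one_minus_tanh prod_eq_iff s_def)
  moreover have "s < m" using p by (simp add: s_def oblique_ray_def)
  ultimately show "p \<in> translation_flow m t ` {..<m}" by blast
qed

text \<open>The points at a given distance from the vertical geodesic form two half-lines from \<open>(m, 0)\<close>,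
  mirror images of each other.\<close>

lemma hyp_infdist_vertical_geodesic_eq_arsinh_iff:
  assumes "k > 0"
  shows "p \<in> H2 \<and> hyp_infdist p (vertical_geodesic m) = arsinh k \<longleftrightarrow>
    snd p > 0 \<and> \<bar>fst p - m\<bar> = k * snd p"
proof (cases "snd p > 0")
  case True
  define z where "z = (fst p - m) / snd p"
  have "\<bar>arsinh z\<bar> = arsinh \<bar>z\<bar>"
    using arsinh_less_iff_real[of z 0] arsinh_less_iff_real[of 0 z]
    by (simp only: arsinh_0) (auto simp: abs_if)
  then have "\<bar>arsinh z\<bar> = arsinh k \<longleftrightarrow> \<bar>z\<bar> = k"
    by (metis sinh_arsinh_real)
  then show ?thesis
    using True by (auto simp: hyp_infdist_vertical_geodesic H2_def z_def abs_divide field_simps)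
qed (simp add: H2_def)

text \<open>The left half-line is a whole component of the distance set: a connected set that also meets the
  right half-line would contain a point over \<open>m\<close>, where the distance is \<open>0\<close>.\<close>

lemma equidistant_line_oblique_ray:
  assumes "k > 0"
  shows "equidistant_line (oblique_ray m k)"
proof -
  define S where "S = {p \<in> H2. hyp_infdist p (vertical_geodesic m) = arsinh k}"
  have S: "p \<in> S \<longleftrightarrow> snd p > 0 \<and> \<bar>fst p - m\<bar> = k * snd p" for p
    using hyp_infdist_vertical_geodesic_eq_arsinh_iff[OF assms, of p m] by (simp add: S_def)
  have left: "oblique_ray m k = {p \<in> S. fst p < m}"
    using assms by (auto simp: S oblique_ray_def abs_if mult_less_0_iff)
  have "(m - k, 1) \<in> oblique_ray m k"
    by (simp add: oblique_ray_def)
  moreover have "connected (oblique_ray m k)"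
  proof -
    have "oblique_ray m k = (\<lambda>h. (m - k * h, h)) ` {0<..}"
      by (auto simp: oblique_ray_def image_iff prod_eq_iff)
    then show ?thesis
      by (simp only:) (intro connected_continuous_image continuous_intros connected_Ioi)
  qed
  moreover have "D = oblique_ray m k"
    if D: "oblique_ray m k \<subseteq> D" "D \<subseteq> S" "connected D" for D
  proof -
    have "fst p < m" if "p \<in> D" for p
    proof (rule ccontr)
      assume "\<not> fst p < m"
      moreover have "(m - k, 1) \<in> D" using D(1) \<open>(m - k, 1) \<in> oblique_ray m k\<close> by blast
      moreover have "connected (fst ` D)"
        by (intro connected_continuous_image continuous_intros D(3))
      ultimately have "m \<in> fst ` D"
        using assms that connectedD_interval[of "fst ` D" "m - k" "fst p" m]
        by (force simp: image_iff)
      then show False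
        using D(2) assms by (force simp: S subset_iff)
    qed
    then show ?thesis using D by (auto simp: left)
  qed
  ultimately have "oblique_ray m k \<in> components S"
    by (auto simp: in_components_maximal left)
  moreover have "arsinh k > 0"
    using arsinh_real_strict_mono[OF assms] by simp
  ultimately show ?thesis
    unfolding equidistant_line_def is_geodesic_def S_def by blast
qed

lemma equidistant_line_translation_flow: "equidistant_line (translation_flow m t ` {..<m})"
  unfolding translation_flow_image by (rule equidistant_line_oblique_ray) simp

lemma geodesic_translation_in_oblique_ray:
  assumes "h > 0"
  shows "geodesic_translation (- arsinh k) (m, h) \<in> oblique_ray m k"
  using assms by (simp add: oblique_ray_def geodesic_translation_def tanh_def)

text \<open>Both Hausdorff estimates come from one correspondence: translation by \<open>- arsinh (exp (- t))\<close>
  takes the vertical geodesic to the slice at time \<open>t\<close>.\<close>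

lemma translation_flow_approaches_vertical_geodesic:
  "approaches (\<lambda>t. translation_flow m t ` {..<m}) (vertical_geodesic m) at_top"
  unfolding approaches_def translation_flow_image
proof (intro allI impI)
  fix \<epsilon> :: real assume "\<epsilon> > 0"
  \<comment> \<open>The slice at time \<open>t\<close> is at distance \<open>arsinh (exp (- t))\<close>, which is less than \<open>\<epsilon>\<close>
      as soon as \<open>exp (- t) < sinh \<epsilon>\<close>.\<close>
  have "((\<lambda>t. exp (- t) :: real) \<longlongrightarrow> 0) at_top"
    by (rule filterlim_compose[OF exp_at_bot filterlim_uminus_at_bot_at_top])
  then have "\<forall>\<^sub>F t in at_top. exp (- t) < sinh \<epsilon>"
    using \<open>\<epsilon> > 0\<close> by (intro order_tendstoD) auto
  then show "\<forall>\<^sub>F t in at_top.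
      (\<forall>p\<in>oblique_ray m (exp (- t)). hyp_infdist p (vertical_geodesic m) < \<epsilon>) \<and>
      (\<forall>q\<in>vertical_geodesic m. hyp_infdist q (oblique_ray m (exp (- t))) < \<epsilon>)"
  proof eventually_elim
    case (elim t)
    define \<tau> where "\<tau> = arsinh (exp (- t))"
    have \<tau>: "0 < \<tau>" "\<tau> < \<epsilon>"
      using arsinh_real_strict_mono[of 0 "exp (- t)"] arsinh_real_strict_mono[OF elim]
      by (auto simp: \<tau>_def arsinh_sinh_real)
    have "hyp_infdist p (vertical_geodesic m) = \<tau>" if "p \<in> oblique_ray m (exp (- t))" for p
      using that hyp_infdist_vertical_geodesic_eq_arsinh_iff[of "exp (- t)" p m]
      by (auto simp: \<tau>_def oblique_ray_def)
    moreover have "hyp_infdist q (oblique_ray m (exp (- t))) \<le> \<tau>" if q: "q \<in> vertical_geodesic m" for q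
    proof -
      have H2: "q \<in> H2" using q vertical_geodesic_subset_H2 by blast
      have "geodesic_translation (- \<tau>) q \<in> oblique_ray m (exp (- t))"
        using q by (auto simp: \<tau>_def vertical_geodesic_def geodesic_translation_in_oblique_ray)
      then have "hyp_infdist q (oblique_ray m (exp (- t))) \<le> hyp_dist q (geodesic_translation (- \<tau>) q)"
        by (intro hyp_infdist_le H2 oblique_ray_subset_H2)
      also have "\<dots> \<le> \<tau>"
        using hyp_dist_geodesic_translation_le[OF H2, of 0 "- \<tau>"] \<tau>(1)
        by (simp add: geodesic_translation_def[of 0])
      finally show ?thesis .
    qed
    ultimately show ?case using \<tau>(2) by force
  qed
qed

text \<open>The complement of a neighbourhood of the ideal boundary is a compact set \<open>K\<close> on which \<open>y > 0\<close>, so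
  \<open>(m - x) / y\<close> is bounded on \<open>K\<close>; on the slice at time \<open>t\<close> it equals \<open>exp (- t)\<close>, which exceeds the
  bound once \<open>t\<close> is sufficiently negative.\<close>

lemma translation_flow_approaches_ideal_boundary:
  "approaches_ideal_boundary (\<lambda>t. translation_flow m t ` {..<m}) at_bot"
  unfolding approaches_ideal_boundary_def translation_flow_image
proof (intro allI impI, elim conjE)
  fix U assume U: "openin compactified_H2 U" and ideal: "ideal_boundary \<subseteq> U"
  obtain K where K: "compact K" "K \<subseteq> closed_half_plane"
    and U_eq: "U = insert None (Some ` (closed_half_plane - K))"
    using U ideal
    by (auto simp: compactified_H2_def openin_Alexandroff_compactification ideal_boundary_def
        compactin_subtopology)
  have K_H2: "snd p > 0" if "p \<in> K" for p
  proof -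
    have "p \<in> closed_half_plane" using K(2) that by blast
    moreover have "snd p \<noteq> 0"
      using that ideal U_eq by (auto simp: ideal_boundary_def)
    ultimately show ?thesis by (simp add: closed_half_plane_def)
  qed
  obtain k where k: "k > 0" "\<And>p. p \<in> K \<Longrightarrow> (m - fst p) / snd p < k"
  proof -
    have "continuous_on K (\<lambda>p. (m - fst p) / snd p)"
      using K_H2 by (intro continuous_intros) (force dest: K_H2)
    then have "bounded ((\<lambda>p. (m - fst p) / snd p) ` K)"
      by (intro compact_imp_bounded compact_continuous_image K)
    then obtain B where "B > 0" "\<forall>x\<in>(\<lambda>p. (m - fst p) / snd p) ` K. norm x \<le> B"
      unfolding bounded_pos by blast
    then show thesis by (intro that[of "B + 1"]) (force simp: abs_le_iff)+
  qed
  have "\<forall>\<^sub>F t in at_bot. t < - ln k"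
    by (rule eventually_gt_at_bot)
  then show "\<forall>\<^sub>F t in at_bot. Some ` oblique_ray m (exp (- t)) \<subseteq> U"
  proof eventually_elim
    case (elim t)
    then have "k < exp (- t)"
      using k(1) by (metis exp_less_mono exp_ln neg_less_iff_less minus_minus)
    have "p \<notin> K" if "p \<in> oblique_ray m (exp (- t))" for p
    proof
      assume "p \<in> K"
      moreover have "(m - fst p) / snd p = exp (- t)"
        using that by (simp add: oblique_ray_def)
      ultimately show False using k(2)[of p] \<open>k < exp (- t)\<close> by simp
    qed
    then show ?case
      by (auto simp: U_eq closed_half_plane_def oblique_ray_def)
  qed
qed


section \<open>Curve shortening by geodesic translations\<close>

lemma velocity_linear_image:
  assumes "bounded_linear L" and "c differentiable at u"
  shows "velocity (\<lambda>s. L (c s)) u = L (velocity c u)"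
  using bounded_linear.has_vector_derivative[OF assms(1)] assms(2)
  by (intro vector_derivative_at) (auto simp: vector_derivative_works)

lemma acceleration_linear_image:
  assumes "bounded_linear L" and "open J" and "u \<in> J"
    and "\<And>s. s \<in> J \<Longrightarrow> c differentiable at s" and "velocity c differentiable at u"
  shows "(velocity (\<lambda>s. L (c s)) has_vector_derivative L (velocity (velocity c) u)) (at u)"
proof (rule has_vector_derivative_transform_within_open[OF _ assms(2,3)])
  show "((\<lambda>s. L (velocity c s)) has_vector_derivative L (velocity (velocity c) u)) (at u)"
    using bounded_linear.has_vector_derivative[OF assms(1)] assms(5)
    by (auto simp: vector_derivative_works)
qed (simp add: velocity_linear_image assms)

lemma regular_onD:
  assumes "regular_on J c" and "u \<in> J"
  shows "c differentiable at u" "velocity c u \<noteq> 0" "velocity c differentiable at u"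
  using assms by (auto simp: regular_on_def C1_differentiable_on_eq)

lemma regular_on_linear_image:
  assumes L: "bounded_linear L" and "open J" and c: "regular_on J c"
    and nz: "\<And>u. u \<in> J \<Longrightarrow> L (velocity c u) \<noteq> 0"
  shows "regular_on J (\<lambda>s. L (c s))"
proof -
  have "velocity (\<lambda>s. L (c s)) C1_differentiable_on J"
    unfolding C1_differentiable_on_def
  proof (intro exI conjI ballI)
    show "(velocity (\<lambda>s. L (c s)) has_vector_derivative L (velocity (velocity c) u)) (at u)"
      if "u \<in> J" for u
      using acceleration_linear_image[OF L assms(2) that] regular_onD[OF c] that by blast
    have "continuous_on J (velocity (velocity c))"
      using c by (auto simp: regular_on_def C1_differentiable_on_eq)
    then show "continuous_on J (\<lambda>u. L (velocity (velocity c) u))"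
      by (rule bounded_linear.continuous_on[OF L])
  qed
  moreover have "(\<lambda>s. L (c s)) differentiable at u" if "u \<in> J" for u
    using bounded_linear.has_vector_derivative[OF L] regular_onD(1)[OF c that]
    by (meson differentiableI_vector vector_derivative_works)
  ultimately show ?thesis
    unfolding regular_on_def using nz velocity_linear_image[OF L regular_onD(1)[OF c]] by auto
qed

lemma bounded_linear_geodesic_translation: "bounded_linear (geodesic_translation t)"
  unfolding geodesic_translation_def[abs_def]
  by (subst linear_conv_bounded_linear[symmetric], rule linearI)
    (auto simp: field_simps)

lemma geodesic_translation_eq_0_iff [simp]: "geodesic_translation t v = 0 \<longleftrightarrow> v = 0"
  by (auto simp: geodesic_translation_def prod_eq_iff)

lemma geodesic_translation_0 [simp]: "geodesic_translation 0 p = p"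
  by (simp add: geodesic_translation_def)

lemma param_curve_geodesic_translation:
  assumes "param_curve J c"
  shows "param_curve J (\<lambda>s. geodesic_translation t (c s))"
proof -
  have J: "open J" and c: "regular_on J c" and "c ` J \<subseteq> H2"
    using assms by (auto simp: param_curve_def)
  have "regular_on J (\<lambda>s. geodesic_translation t (c s))"
    by (rule regular_on_linear_image[OF bounded_linear_geodesic_translation J c])
      (simp add: regular_onD(2)[OF c])
  moreover have "(\<lambda>s. geodesic_translation t (c s)) ` J \<subseteq> H2"
    using \<open>c ` J \<subseteq> H2\<close> by (blast intro: geodesic_translation_in_H2)
  ultimately show ?thesis
    using assms by (simp add: param_curve_def)
qed

text \<open>The unit normal of a regular curve does not vanish, so the vector equation of the flow reduces to
  its scalar coefficient.\<close>

lemma normal_part_eq_iff: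
  assumes "velocity c u \<noteq> 0" and "c u \<in> H2"
  shows "normal_part c u v = k *\<^sub>R unit_normal c u \<longleftrightarrow>
    hyp_inner (c u) v (unit_normal c u) = k"
proof -
  have "(fst (velocity c u))\<^sup>2 + (snd (velocity c u))\<^sup>2 \<noteq> 0"
    using assms(1) by (simp add: sum_power2_eq_zero_iff prod_eq_iff)
  then have "unit_normal c u \<noteq> 0"
    using assms by (auto simp: unit_normal_def Let_def H2_def prod_eq_iff)
  then show ?thesis by (simp add: normal_part_def)
qed

text \<open>The vector on the left is the time derivative of the translations. With
  \<open>w\<^sup>2 = x'\<^sup>2 + y'\<^sup>2 + 2 T x' y'\<close>, the squared Euclidean speed of the translated curve, the
  normal component of that vector is \<open>- (y' + T x') / w\<close>, while the curvature is
  \<open>(1 - T\<^sup>2) y (x' y'' - x'' y') / w\<^sup>3 + (x' + T y') / w\<close>.\<close>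

lemma translated_csf_equation_iff:
  fixes t :: real
  assumes J: "open J" "u \<in> J" and c: "regular_on J c" "c u \<in> H2"
  defines "x' \<equiv> fst (velocity c u)" and "y' \<equiv> snd (velocity c u)"
    and "x'' \<equiv> fst (velocity (velocity c) u)" and "y'' \<equiv> snd (velocity (velocity c) u)"
    and "ct \<equiv> \<lambda>s. geodesic_translation t (c s)"
  shows "normal_part ct u (snd (c u) / (cosh t)\<^sup>2, - snd (c u) * tanh t / cosh t)
      = curvature ct u *\<^sub>R unit_normal ct u \<longleftrightarrow>
    (x' + y') * (x'\<^sup>2 + y'\<^sup>2 + 2 * tanh t * x' * y')
      + (1 - tanh t) * snd (c u) * (x' * y'' - x'' * y') = 0"
proof -
  define T C y D where "T = tanh t" and "C = cosh t" and "y = snd (c u)"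
    and "D = x' * y'' - x'' * y'"
  define q where "q = x'\<^sup>2 + y'\<^sup>2 + 2 * T * x' * y'"
  have y: "y > 0" using c(2) by (simp add: H2_def y_def)
  have C: "C > 0" by (simp add: C_def)
  have TC: "1 / C\<^sup>2 = 1 - T\<^sup>2" using one_minus_tanh_square[of t] by (simp add: T_def C_def)
  have T: "1 + T > 0" using tanh_real_gt_neg1[of t] by (simp add: T_def)
  have vel: "velocity ct u = (x' + y' * T, y' / C)"
    unfolding ct_def
    by (subst velocity_linear_image[OF bounded_linear_geodesic_translation regular_onD(1)[OF c(1) J(2)]])
      (simp add: geodesic_translation_def x'_def y'_def T_def C_def)
  have acc: "velocity (velocity ct) u = (x'' + y'' * T, y'' / C)"
    unfolding ct_def
    using vector_derivative_at[OF acceleration_linear_image[OF bounded_linear_geodesic_translation J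
          regular_onD(1)[OF c(1)] regular_onD(3)[OF c(1) J(2)]]]
    by (simp add: geodesic_translation_def x''_def y''_def T_def C_def)
  have pos: "snd (ct u) = y / C"
    by (simp add: ct_def geodesic_translation_def y_def C_def)
  have "(y' / C)\<^sup>2 = y'\<^sup>2 * (1 - T\<^sup>2)"
    by (simp add: power_divide flip: TC)
  then have speed: "(x' + y' * T)\<^sup>2 + (y' / C)\<^sup>2 = q"
    by (simp add: q_def power2_eq_square algebra_simps)
  have vel_nz: "velocity ct u \<noteq> 0"
    unfolding ct_def velocity_linear_image[OF bounded_linear_geodesic_translation regular_onD(1)[OF c(1) J(2)]]
    using regular_onD(2)[OF c(1) J(2)] by simp
  have ct_H2: "ct u \<in> H2"
    unfolding ct_def by (rule geodesic_translation_in_H2[OF c(2)])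
  have q: "q > 0"
    using vel_nz unfolding vel by (simp add: speed[symmetric] sum_power2_gt_zero_iff prod_eq_iff)
  \<comment> \<open>The denominators in the normal and in the curvature are powers of the speed \<open>W\<close>.\<close>
  define W where "W = sqrt q"
  have W: "W > 0" "W\<^sup>2 = q" using q by (simp_all add: W_def)
  have "q powr (3 / 2) = W ^ 3"
    using q by (simp add: W_def powr_half_sqrt[symmetric] powr_powr flip: powr_numeral)
  then have curv: "curvature ct u = (1 - T\<^sup>2) * y * D / W ^ 3 + (x' + y' * T) / W"
    using C W(1) by (simp add: curvature_def Let_def vel acc pos speed W_def[symmetric] D_def flip: TC)
      (simp add: divide_simps power2_eq_square, simp add: algebra_simps)
  have "hyp_inner (ct u) (y / C\<^sup>2, - y * T / C) (unit_normal ct u)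
      = - (y' * (1 / C\<^sup>2) + T * (x' + y' * T)) / W"
    using C y W(1)
    by (simp add: hyp_inner_def unit_normal_def Let_def vel pos speed W_def[symmetric])
      (simp add: field_simps power2_eq_square)
  also have "\<dots> = - (y' + T * x') / W"
    unfolding TC by (simp add: power2_eq_square algebra_simps)
  finally have inner: "hyp_inner (ct u) (y / C\<^sup>2, - y * T / C) (unit_normal ct u)
      = - (y' + T * x') / W" .
  have "normal_part ct u (y / C\<^sup>2, - y * T / C) = curvature ct u *\<^sub>R unit_normal ct u \<longleftrightarrow>
      - (y' + T * x') / W = (1 - T\<^sup>2) * y * D / W ^ 3 + (x' + y' * T) / W"
    unfolding normal_part_eq_iff[OF vel_nz ct_H2] inner curv ..
  also have "\<dots> \<longleftrightarrow> ((1 - T\<^sup>2) * y * D + (x' + y' * T) * W\<^sup>2 + (y' + T * x') * W\<^sup>2) / W ^ 3 = 0"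
  proof -
    have common: "(a + b * W\<^sup>2 + k * W\<^sup>2) / W ^ 3 = a / W ^ 3 + b / W + k / W" for a b k
      using W(1) by (simp add: add_divide_distrib power2_eq_square power3_eq_cube)
    show ?thesis unfolding common by (simp only: minus_divide_left[symmetric]) linarith
  qed
  also have "\<dots> \<longleftrightarrow> (1 + T) * ((x' + y') * q + (1 - T) * y * D) = 0"
  proof -
    have "(1 - T\<^sup>2) * y * D + (x' + y' * T) * q + (y' + T * x') * q =
        (1 + T) * ((x' + y') * q + (1 - T) * y * D)"
      by algebra
    then show ?thesis using W(1) by (simp add: W(2))
  qed
  also have "\<dots> \<longleftrightarrow> (x' + y') * q + (1 - T) * y * D = 0"
    using T by simp
  finally show ?thesis
    by (simp only: q_def T_def C_def y_def D_def)
qed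

text \<open>The time derivative within \<open>T\<close> is unique because an interval with more than one point has no
  isolated points.\<close>

lemma evolves_by_geodesic_translations_iff:
  assumes c: "param_curve J c" and T: "is_interval T" "0 \<in> T" "T \<noteq> {0}"
  shows "evolves_by_geodesic_translations T J c \<longleftrightarrow> (\<forall>t\<in>T. \<forall>u\<in>J.
    (let x' = fst (velocity c u); y' = snd (velocity c u);
         x'' = fst (velocity (velocity c) u); y'' = snd (velocity (velocity c) u)
     in (x' + y') * (x'\<^sup>2 + y'\<^sup>2 + 2 * tanh t * x' * y')
       + (1 - tanh t) * snd (c u) * (x' * y'' - x'' * y') = 0))"
proof -
  have velocity_unique: "(\<exists>v. ((\<lambda>\<tau>. geodesic_translation \<tau> (c u)) has_vector_derivative v) (at t within T) \<and> P v)
      \<longleftrightarrow> P (snd (c u) / (cosh t)\<^sup>2, - snd (c u) * tanh t / cosh t)" if "t \<in> T" for t u P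
  proof -
    have "\<And>x. T \<noteq> {x}" using T(2,3) by blast
    then have "at t within T \<noteq> bot"
      using connected_imp_perfect[OF _ that] T(1)
      by (simp add: trivial_limit_within is_interval_connected_1)
    then show ?thesis
      using geodesic_translation_has_vector_derivative[of "c u" t T]
        vector_derivative_unique_within by blast
  qed
  have J: "regular_on J c" "open J" "\<And>u. u \<in> J \<Longrightarrow> c u \<in> H2"
    using c by (auto simp: param_curve_def)
  have "evolves_by_geodesic_translations T J c \<longleftrightarrow> (\<forall>t\<in>T. \<forall>u\<in>J.
      \<exists>v. ((\<lambda>\<tau>. geodesic_translation \<tau> (c u)) has_vector_derivative v) (at t within T) \<and>
        normal_part (\<lambda>s. geodesic_translation t (c s)) u v =
        curvature (\<lambda>s. geodesic_translation t (c s)) u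
          *\<^sub>R unit_normal (\<lambda>s. geodesic_translation t (c s)) u)"
    unfolding evolves_by_geodesic_translations_def curve_shortening_flow_def
    using T param_curve_geodesic_translation[OF c] by simp
  also have "\<dots> \<longleftrightarrow> (\<forall>t\<in>T. \<forall>u\<in>J.
      normal_part (\<lambda>s. geodesic_translation t (c s)) u
        (snd (c u) / (cosh t)\<^sup>2, - snd (c u) * tanh t / cosh t) =
      curvature (\<lambda>s. geodesic_translation t (c s)) u
        *\<^sub>R unit_normal (\<lambda>s. geodesic_translation t (c s)) u)"
    by (intro ball_cong refl velocity_unique)
  finally show ?thesis
    unfolding Let_def using translated_csf_equation_iff[OF J(2) _ J(1,3)] by simp
qed

text \<open>Eliminating \<open>k\<close> from the equations at time \<open>0\<close> and at a second time leaves \<open>T (a + b)\<^sup>3 = 0\<close>.\<close>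

lemma csf_equations_imp_slope_minus_one:
  fixes a b k T :: real
  assumes "(a + b) * (a\<^sup>2 + b\<^sup>2) + k = 0"
    and "(a + b) * (a\<^sup>2 + b\<^sup>2 + 2 * T * a * b) + (1 - T) * k = 0" and "T \<noteq> 0"
  shows "a + b = 0"
proof -
  have "T * (a + b) ^ 3 = 0"
    using assms(1,2) by algebra
  then show ?thesis using assms(3) by simp
qed

lemma evolves_by_geodesic_translations_imp_sum_constant:
  assumes c: "param_curve J c" and evolves: "evolves_by_geodesic_translations T J c"
  obtains m where "\<And>u. u \<in> J \<Longrightarrow> fst (c u) + snd (c u) = m"
proof -
  have T: "is_interval T" "0 \<in> T" "T \<noteq> {0}"
    using evolves by (auto simp: evolves_by_geodesic_translations_def curve_shortening_flow_def)
  then obtain t where t: "t \<in> T" "t \<noteq> 0" by blast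
  note eq = evolves[unfolded evolves_by_geodesic_translations_iff[OF c T] Let_def, rule_format]
  define L where "L = (\<lambda>p :: real \<times> real. fst p + snd p)"
  have L: "bounded_linear L"
    unfolding L_def by (intro bounded_linear_add bounded_linear_fst bounded_linear_snd)
  have "((\<lambda>u. L (c u)) has_vector_derivative 0) (at u within J)" if u: "u \<in> J" for u
  proof -
    define k where "k = snd (c u) * (fst (velocity c u) * snd (velocity (velocity c) u)
      - fst (velocity (velocity c) u) * snd (velocity c u))"
    have "L (velocity c u) = 0"
      unfolding L_def
    proof (rule csf_equations_imp_slope_minus_one[where k=k and T="tanh t"])
      show "(fst (velocity c u) + snd (velocity c u)) *
          ((fst (velocity c u))\<^sup>2 + (snd (velocity c u))\<^sup>2) + k = 0"
        using eq[OF T(2) u] by (simp add: k_def)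
      show "(fst (velocity c u) + snd (velocity c u)) * ((fst (velocity c u))\<^sup>2
          + (snd (velocity c u))\<^sup>2 + 2 * tanh t * fst (velocity c u) * snd (velocity c u))
          + (1 - tanh t) * k = 0"
        using eq[OF t(1) u] by (simp add: k_def mult.assoc)
      show "tanh t \<noteq> 0" using t(2) by simp
    qed
    moreover have "c differentiable at u"
      using c u regular_onD(1) by (auto simp: param_curve_def)
    ultimately have "((\<lambda>u. L (c u)) has_vector_derivative 0) (at u)"
      using bounded_linear.has_vector_derivative[OF L] by (metis vector_derivative_works)
    then show ?thesis by (rule has_vector_derivative_at_within)
  qed
  moreover have "convex J"
    using c by (simp add: param_curve_def is_interval_convex)
  ultimately obtain m where "\<And>u. u \<in> J \<Longrightarrow> L (c u) = m"
    using has_vector_derivative_zero_constant by metis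
  then show thesis using that by (simp add: L_def)
qed

text \<open>In particular \<open>x' y'' - x'' y' = 0\<close>, so both terms of the flow equation vanish at every time.\<close>

lemma derivatives_of_sum_constant:
  assumes c: "param_curve J c" and sum: "\<And>u. u \<in> J \<Longrightarrow> fst (c u) + snd (c u) = m" and u: "u \<in> J"
  shows "snd (velocity c u) = - fst (velocity c u)"
    and "snd (velocity (velocity c) u) = - fst (velocity (velocity c) u)"
proof -
  define L where "L = (\<lambda>p :: real \<times> real. fst p + snd p)"
  have L: "bounded_linear L"
    unfolding L_def by (intro bounded_linear_add bounded_linear_fst bounded_linear_snd)
  have J: "open J" and r: "regular_on J c" using c by (auto simp: param_curve_def)
  have zero: "velocity f v = 0" if "v \<in> J" "\<And>s. s \<in> J \<Longrightarrow> f s = k" for f :: "real \<Rightarrow> real" and v k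
    by (rule vector_derivative_at,
        rule has_vector_derivative_transform_within_open[OF has_vector_derivative_const[of k] J that(1)])
      (simp add: that(2))
  have vel: "velocity (\<lambda>s. L (c s)) v = 0" if "v \<in> J" for v
    using zero[OF that, of "\<lambda>s. L (c s)" m] sum by (simp add: L_def)
  then have "L (velocity c u) = 0"
    using u velocity_linear_image[OF L regular_onD(1)[OF r u]] by simp
  then show "snd (velocity c u) = - fst (velocity c u)" by (simp add: L_def)
  have "L (velocity (velocity c) u) = velocity (velocity (\<lambda>s. L (c s))) u"
    using vector_derivative_at[OF acceleration_linear_image[OF L J u regular_onD(1)[OF r] regular_onD(3)[OF r u]]]
    by simp
  also have "\<dots> = 0" using zero[OF u vel] .
  finally show "snd (velocity (velocity c) u) = - fst (velocity (velocity c) u)" by (simp add: L_def)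
qed

lemma sum_constant_imp_evolves_by_geodesic_translations:
  assumes c: "param_curve J c" and "\<And>u. u \<in> J \<Longrightarrow> fst (c u) + snd (c u) = m"
  shows "evolves_by_geodesic_translations UNIV J c"
proof -
  have "UNIV \<noteq> {0 :: real}" using UNIV_I[of "1 :: real"] by (metis singletonD zero_neq_one)
  show ?thesis
    unfolding evolves_by_geodesic_translations_iff[OF c is_interval_univ UNIV_I \<open>UNIV \<noteq> {0}\<close>]
    by (simp add: Let_def derivatives_of_sum_constant[OF assms])
qed

lemma abs_curvature_sum_constant:
  assumes c: "param_curve J c" and "\<And>u. u \<in> J \<Longrightarrow> fst (c u) + snd (c u) = m" and u: "u \<in> J"
  shows "\<bar>curvature c u\<bar> = 1 / sqrt 2"
proof -
  have d: "snd (velocity c u) = - fst (velocity c u)"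
      "snd (velocity (velocity c) u) = - fst (velocity (velocity c) u)"
    using derivatives_of_sum_constant[OF assms] by auto
  have "velocity c u \<noteq> 0" using c u regular_onD(2) by (auto simp: param_curve_def)
  then have "fst (velocity c u) \<noteq> 0" using d(1) by (auto simp: prod_eq_iff)
  then show ?thesis
    by (simp add: curvature_def Let_def d real_sqrt_mult flip: mult_2)
qed

lemma translation_flow_eq_geodesic_translation:
  "translation_flow m t s = geodesic_translation t (s, m - s)"
  by (simp add: translation_flow_def geodesic_translation_def)

lemma translation_flow_has_vector_derivative:
  "(translation_flow m t has_vector_derivative (1 - tanh t, - 1 / cosh t)) (at s)"
  unfolding translation_flow_def[abs_def]
  by (intro has_vector_derivative_Pair; unfold has_real_derivative_iff_has_vector_derivative[symmetric])
    (auto intro!: derivative_eq_intros)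

lemma velocity_translation_flow: "velocity (translation_flow m t) s = (1 - tanh t, - 1 / cosh t)"
  by (rule vector_derivative_at, rule translation_flow_has_vector_derivative)

lemma param_curve_translation_flow: "param_curve {..<m} (translation_flow m t)"
proof -
  have "translation_flow m t ` {..<m} \<subseteq> H2"
    by (auto simp: translation_flow_def H2_def)
  moreover have "translation_flow m t differentiable at s" for s
    using translation_flow_has_vector_derivative by (rule differentiableI_vector)
  ultimately show ?thesis
    using lt_ex[of m]
    by (auto simp: param_curve_def regular_on_def velocity_translation_flow is_interval_1 prod_eq_iff)
qed

lemma curve_shortening_flow_translation_flow:
  "curve_shortening_flow UNIV {..<m} (translation_flow m 0) (translation_flow m)"
proof -
  have "evolves_by_geodesic_translations UNIV {..<m} (translation_flow m 0)"
    by (rule sum_constant_imp_evolves_by_geodesic_translations[OF param_curve_translation_flow, of _ _ m])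
      (simp add: translation_flow_def)
  moreover have "(\<lambda>t s. geodesic_translation t (translation_flow m 0 s)) = translation_flow m"
    by (simp add: translation_flow_eq_geodesic_translation fun_eq_iff)
  ultimately show ?thesis
    by (simp add: evolves_by_geodesic_translations_def)
qed

lemma curvature_translation_flow: "curvature (translation_flow m t) s = sqrt ((1 - tanh t) / 2)"
proof -
  have T: "1 - tanh t > 0" using tanh_real_lt_1[of t] by simp
  have "(1 - tanh t)\<^sup>2 + (1 / cosh t)\<^sup>2 = 2 * (1 - tanh t)"
    by (simp add: power_divide flip: one_minus_tanh_square) (simp add: power2_eq_square algebra_simps)
  then have "curvature (translation_flow m t) s = (1 - tanh t) / sqrt (2 * (1 - tanh t))"
    by (simp add: curvature_def Let_def velocity_translation_flow)
  also have "\<dots> = (1 - tanh t) / sqrt (1 - tanh t) / sqrt 2"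
    unfolding real_sqrt_mult by simp
  also have "\<dots> = sqrt ((1 - tanh t) / 2)"
    using T by (simp add: real_div_sqrt real_sqrt_divide)
  finally show ?thesis .
qed


section \<open>Classification of the translating curves\<close>

lemma inj_on_nonzero_derivative:
  fixes f :: "real \<Rightarrow> real"
  assumes J: "is_interval J" and f: "\<And>u. u \<in> J \<Longrightarrow> (f has_real_derivative f' u) (at u)"
    and nz: "\<And>u. u \<in> J \<Longrightarrow> f' u \<noteq> 0"
  shows "inj_on f J"
proof (rule linorder_inj_onI')
  fix a b assume ab: "a \<in> J" "b \<in> J" "a < b"
  have sub: "x \<in> J" if "a \<le> x" "x \<le> b" for x
    using J ab that by (meson is_interval_1)
  obtain z where "a < z" "z < b" "f b - f a = (b - a) * f' z"
    using MVT2[OF ab(3), of f f'] f sub by blast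
  then show "f a \<noteq> f b" using nz[OF sub[of z]] ab(3) by auto
qed

lemma open_image_nonzero_derivative:
  fixes f :: "real \<Rightarrow> real"
  assumes J: "open J" and f: "\<And>u. u \<in> J \<Longrightarrow> (f has_real_derivative f' u) (at u)"
    and nz: "\<And>u. u \<in> J \<Longrightarrow> f' u \<noteq> 0"
  shows "open (f ` J)"
proof -
  have "f u \<in> interior (f ` J)" if u: "u \<in> J" for u
  proof (rule sussmann_open_mapping[OF J _ u])
    show "continuous_on J f"
      using f by (meson DERIV_isCont continuous_at_imp_continuous_on)
    show "(f has_derivative (\<lambda>h. f' u * h)) (at u)"
      using f[OF u] by (simp add: has_field_derivative_def)
    show "bounded_linear (\<lambda>h. h / f' u)" by (rule bounded_linear_divide)
    show "(\<lambda>h. f' u * h) \<circ> (\<lambda>h. h / f' u) = id" using nz[OF u] by (auto simp: fun_eq_iff)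
    show "u \<in> interior J" using J u by (simp add: interior_open)
  qed auto
  then show ?thesis by (metis image_subsetI interior_eq interior_subset subset_antisym)
qed

text \<open>A proper map is closed, so the image of the curve is closed in the half-plane, and its projection
  is closed in the connected set \<open>{..<m}\<close>.\<close>

lemma proper_sum_constant_imp_onto:
  assumes c: "param_curve J c" and sum: "\<And>u. u \<in> J \<Longrightarrow> fst (c u) + snd (c u) = m"
    and opn: "open ((\<lambda>u. fst (c u)) ` J)" and proper: "proper_map (top_of_set J) (top_of_set H2) c"
  shows "(\<lambda>u. fst (c u)) ` J = {..<m}"
proof -
  have H2: "c u \<in> H2" if "u \<in> J" for u using c that by (auto simp: param_curve_def)
  have sub: "(\<lambda>u. fst (c u)) ` J \<subseteq> {..<m}"
  proof (rule image_subsetI)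
    fix u assume "u \<in> J"
    then show "fst (c u) \<in> {..<m}" using sum[of u] H2[of u] by (simp add: H2_def)
  qed
  have "closedin (top_of_set H2) (c ` J)"
    using proper_imp_closed_map[OF proper] closedin_topspace[of "top_of_set J"]
    unfolding closed_map_def by (metis topspace_euclidean_subtopology)
  then have "closedin (top_of_set {..<m}) ({..<m} \<inter> (\<lambda>s. (s, m - s)) -` (c ` J))"
    by (intro continuous_closedin_preimage_gen continuous_intros) (auto simp: H2_def)
  moreover have "{..<m} \<inter> (\<lambda>s. (s, m - s)) -` (c ` J) = (\<lambda>u. fst (c u)) ` J"
  proof (intro equalityI subsetI)
    fix s assume "s \<in> {..<m} \<inter> (\<lambda>s. (s, m - s)) -` (c ` J)"
    then obtain u where "u \<in> J" "c u = (s, m - s)" by auto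
    then show "s \<in> (\<lambda>u. fst (c u)) ` J" by force
  next
    fix s assume s: "s \<in> (\<lambda>u. fst (c u)) ` J"
    then obtain u where u: "u \<in> J" "s = fst (c u)" by blast
    then have "(s, m - s) = c u" using sum[OF u(1)] by (simp add: prod_eq_iff)
    moreover have "s < m" using s sub by blast
    ultimately show "s \<in> {..<m} \<inter> (\<lambda>s. (s, m - s)) -` (c ` J)"
      using u(1) by simp
  qed
  ultimately have "closedin (top_of_set {..<m}) ((\<lambda>u. fst (c u)) ` J)" by simp
  moreover have "openin (top_of_set {..<m}) ((\<lambda>u. fst (c u)) ` J)"
    using opn sub by (simp add: open_openin_trans)
  moreover have "J \<noteq> {}" using c by (simp add: param_curve_def)
  ultimately show ?thesis
    using connected_Iio[of m] unfolding connected_clopen by blast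
qed

theorem proposition3p2:
  fixes T J :: "real set" and \<gamma> :: "real \<Rightarrow> real \<times> real"
  assumes "param_curve J \<gamma>"
    and "evolves_by_geodesic_translations T J \<gamma>"
  shows "\<exists>m \<phi>.
      \<comment> \<open>the curve is an equidistant line of curvature \<open>1 / sqrt 2\<close>, or an open arc of one
          if it is not properly immersed\<close>
      (\<exists>E. equidistant_line E \<and> \<gamma> ` J \<subseteq> E \<and>
         (proper_map (top_of_set J) (top_of_set H2) \<gamma> \<longrightarrow> \<gamma> ` J = E)) \<and>
      (\<forall>s\<in>J. \<bar>curvature \<gamma> s\<bar> = 1 / sqrt 2) \<and>
      \<comment> \<open>the flow, after the change of parameter \<open>\<phi>\<close>\<close>
      regular_on J \<phi> \<and> inj_on \<phi> J \<and> \<phi> ` J \<subseteq> {..<m} \<and>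
      (proper_map (top_of_set J) (top_of_set H2) \<gamma> \<longrightarrow> \<phi> ` J = {..<m}) \<and>
      (\<forall>t. \<forall>s\<in>J. geodesic_translation t (\<gamma> s) = translation_flow m t (\<phi> s)) \<and>
      \<comment> \<open>(1)\<close>
      evolves_by_geodesic_translations UNIV J \<gamma> \<and>
      curve_shortening_flow UNIV {..<m} (translation_flow m 0) (translation_flow m) \<and>
      approaches (\<lambda>t. translation_flow m t ` {..<m}) (vertical_geodesic m) at_top \<and>
      approaches_ideal_boundary (\<lambda>t. translation_flow m t ` {..<m}) at_bot \<and>
      \<comment> \<open>(2)\<close>
      (\<forall>t. equidistant_line (translation_flow m t ` {..<m}) \<and>
         (\<forall>s<m. curvature (translation_flow m t) s = sqrt ((1 - tanh t) / 2)))"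
proof -
  obtain m where sum: "\<And>u. u \<in> J \<Longrightarrow> fst (\<gamma> u) + snd (\<gamma> u) = m"
    using evolves_by_geodesic_translations_imp_sum_constant[OF assms] by blast
  define \<phi> where "\<phi> = (\<lambda>u. fst (\<gamma> u))"
  have J: "open J" "is_interval J" and reg: "regular_on J \<gamma>" and H2: "\<gamma> ` J \<subseteq> H2"
    using assms(1) by (auto simp: param_curve_def)
  have \<gamma>_eq: "\<gamma> u = (\<phi> u, m - \<phi> u)" if "u \<in> J" for u
    using sum[OF that] by (auto simp: \<phi>_def prod_eq_iff)
  have nz: "fst (velocity \<gamma> u) \<noteq> 0" if "u \<in> J" for u
    using regular_onD(2)[OF reg that] derivatives_of_sum_constant(1)[OF assms(1) sum that]
    by (auto simp: prod_eq_iff)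
  have deriv: "(\<phi> has_real_derivative fst (velocity \<gamma> u)) (at u)" if "u \<in> J" for u
    unfolding \<phi>_def has_real_derivative_iff_has_vector_derivative
    using bounded_linear.has_vector_derivative[OF bounded_linear_fst] regular_onD(1)[OF reg that]
    by (metis vector_derivative_works)
  have flow: "geodesic_translation t (\<gamma> u) = translation_flow m t (\<phi> u)" if "u \<in> J" for t u
    by (simp add: translation_flow_eq_geodesic_translation \<gamma>_eq[OF that])
  have sub: "\<phi> ` J \<subseteq> {..<m}"
    using H2 \<gamma>_eq by (force simp: H2_def)
  have onto: "\<phi> ` J = {..<m}" if "proper_map (top_of_set J) (top_of_set H2) \<gamma>"
    using proper_sum_constant_imp_onto[OF assms(1) sum _ that]
      open_image_nonzero_derivative[OF J(1) deriv nz] by (simp add: \<phi>_def)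
  have img: "\<gamma> ` J = translation_flow m 0 ` (\<phi> ` J)"
    unfolding image_image by (rule image_cong) (use flow[of _ 0] in auto)
  show ?thesis
  proof (intro exI[of _ m] exI[of _ \<phi>] exI[of _ "translation_flow m 0 ` {..<m}"] conjI allI ballI impI)
    show "equidistant_line (translation_flow m 0 ` {..<m})"
      and "equidistant_line (translation_flow m t ` {..<m})" for t
      by (rule equidistant_line_translation_flow)+
    show "\<gamma> ` J \<subseteq> translation_flow m 0 ` {..<m}"
      unfolding img using sub by (rule image_mono)
    show "\<gamma> ` J = translation_flow m 0 ` {..<m}"
      if "proper_map (top_of_set J) (top_of_set H2) \<gamma>"
      unfolding img onto[OF that] ..
    show "\<bar>curvature \<gamma> u\<bar> = 1 / sqrt 2" if "u \<in> J" for u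
      by (rule abs_curvature_sum_constant[OF assms(1) sum that])
    show "regular_on J \<phi>"
      unfolding \<phi>_def by (rule regular_on_linear_image[OF bounded_linear_fst J(1) reg nz])
    show "inj_on \<phi> J"
      by (rule inj_on_nonzero_derivative[OF J(2) deriv nz])
    show "evolves_by_geodesic_translations UNIV J \<gamma>"
      by (rule sum_constant_imp_evolves_by_geodesic_translations[OF assms(1) sum])
    show "curvature (translation_flow m t) u = sqrt ((1 - tanh t) / 2)" for t u
      by (rule curvature_translation_flow)
  qed (fact sub onto flow curve_shortening_flow_translation_flow
      translation_flow_approaches_vertical_geodesic translation_flow_approaches_ideal_boundary)+
qed

end
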